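(* Let $n\ge2$ and let $\mathbf t=(t_0,u_0,t,t_n,u_n)\in\mathbb C^5$ be such that $\gamma_\lambda\ne\gamma_\mu$ whenever $\lambda\neq\mu$ in $\Lambda=\mathbb Z^n$. For every $f\in\mathcal P=\mathbb C[x_1,\dots,x_n]$ and $\lambda\in\Lambda$, the nonsymmetric multivariable Wilson polynomial $p_\lambda$ satisfies $$f(Y)p_\lambda=f(\gamma_\lambda)p_\lambda .$$
   Context: Notation: $[m,n]=\{m,m+1,\dots,n\}$, $\mathcal P=\mathbb C[x_1,\dots,x_n]$, $\Lambda=\mathbb Z^n$. $W$ is the affine Weyl group of type $\widetilde C_n$, the Coxeter group with generators $s_0,\dots,s_n$, realized faithfully on $\mathbb C^n$ by $s_0x=(1-x_1,x_2,\dots,x_n)$, $s_i$ interchanging $x_i$ and $x_{i+1}$ ($i\in[1,n-1]$), $s_nx=(x_1,\dots,x_{n-1},-x_n)$; it acts on functions by $(wp)(x)=p(w^{-1}x)$. Put $a_0(x)=1-2x_1$, $a_i(x)=x_i-x_{i+1}$ ($i\in[1,n-1]$), $a_n(x)=2x_n$. Operators on $\mathcal P$: $X_i$ is multiplication by $x_i$, and $T_ip=\chi_i\,s_ip+d_i\,(s_ip-p)$ ($i\in[0,n]$), where $\chi_0=t_0$, $\chi_n=t_n$, $\chi_i=1$ for $i\in[1,n-1]$, $d_0(x)=\frac{t_0^2-u_0^2+(\frac12-x_1)^2}{1-2x_1}$, $d_i(x)=\frac{t}{x_i-x_{i+1}}$ ($i\in[1,n-1]$), $d_n(x)=\frac{t_n^2-u_n^2+x_n^2}{2x_n}$.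 For $1\le i<j\le n$ put $T_{i,j}=T_iT_{i+1}\cdots T_{j-2}T_{j-1}T_{j-2}\cdots T_{i+1}T_i$. The operators $$Y_i=T_i\cdots T_{n-1}T_nT_{n-1}\cdots T_i+T_{i-1}\cdots T_1T_0T_1\cdots T_{i-1}+t\sum_{j=i+1}^nT_{i,j}\qquad(i\in[1,n])$$ commute pairwise, and $f(Y)$ denotes $f$ evaluated at $(Y_1,\dots,Y_n)$. Put $U_n=T_1\cdots T_{n-1}(-X_n-T_n)T_{n-1}\cdots T_1$. Intertwiners: $S_0=[U_n,a_0(Y)]$, $S_i=[T_i,a_i(Y)]$ ($i\in[1,n]$). They satisfy the braid relations of $W$, so $S_w=S_{i_1}\cdots S_{i_r}$ for a reduced expression $w=s_{i_1}\cdots s_{i_r}$ is well defined ($S_1=1$). The dot action of $W$ on $\mathbb C^n$ is $s_i\cdot x=s_ix$ for $i\in[1,n]$ and $s_0\cdot x=(-x_1-1,x_2,\dots,x_n)$; it preserves $\Lambda$. For $\lambda\in\Lambda$, $u_\lambda$ is the unique shortest element of $W$ (length with respect to $s_0,\dots,s_n$) with $u_\lambda\cdot0=\lambda$. The nonsymmetric multivariable Wilson polynomial is $p_\lambda=S_{u_\lambda}1\in\mathcal P$. Finally $\gamma_0=(\gamma_{0,1},\dots,\gamma_{0,n})$ with $\gamma_{0,i}=t_0+t_n+(n-i)t$ and $\gamma_\lambda=u_\lambda\cdot\gamma_0$. *)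

theory Defs
  imports Complex_Main "HOL-Library.Poly_Mapping"
begin

section \<open>Polynomials in \<open>x\<^sub>1, \<dots>, x\<^sub>n\<close>\<close>

text \<open>
  A polynomial is a finitely supported map from exponent vectors to coefficients.  The ambient
  ring has a variable for every natural number; \<open>polys n\<close> is the subring in \<open>x\<^sub>1, \<dots>, x\<^sub>n\<close>.
  Likewise \<open>\<complex>\<^sup>n\<close> and \<open>\<int>\<^sup>n\<close> are modelled by functions on the natural numbers, of which only the
  values at \<open>1, \<dots>, n\<close> matter.
\<close>

type_synonym cpoly = "(nat \<Rightarrow>\<^sub>0 nat) \<Rightarrow>\<^sub>0 complex"

definition polys :: "nat \<Rightarrow> cpoly set" where
  "polys n = {p. \<forall>m \<in> Poly_Mapping.keys p. Poly_Mapping.keys m \<subseteq> {1..n}}"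

definition C :: "complex \<Rightarrow> cpoly" where
  "C c = Poly_Mapping.single 0 c"

definition X :: "nat \<Rightarrow> cpoly" where
  "X i = Poly_Mapping.single (Poly_Mapping.single i 1) 1"

text \<open>Evaluation at \<open>x\<close>, the coefficients being mapped along the ring homomorphism \<open>h\<close>.\<close>

definition insertion :: "(complex \<Rightarrow> 'a) \<Rightarrow> (nat \<Rightarrow> 'a) \<Rightarrow> cpoly \<Rightarrow> 'a::comm_ring_1" where
  "insertion h x p = (\<Sum>m \<in> Poly_Mapping.keys p.
     h (Poly_Mapping.lookup p m) *
     (\<Prod>i \<in> Poly_Mapping.keys m. x i ^ Poly_Mapping.lookup m i))"

definition eval_at :: "(nat \<Rightarrow> complex) \<Rightarrow> cpoly \<Rightarrow> complex" where
  "eval_at x p = insertion id x p"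

definition exact_quot :: "cpoly \<Rightarrow> cpoly \<Rightarrow> cpoly" where
  "exact_quot p a = (THE q. a * q = p)"


section \<open>The affine Weyl group of type \<open>C\<^sub>n\<close> and its dot action\<close>

text \<open>
  The coordinate ring is left arbitrary, so that the same formula describes \<open>s\<^sub>i\<close> on points and,
  applied to the vector of variables, on polynomials.
\<close>

definition refl :: "nat \<Rightarrow> nat \<Rightarrow> (nat \<Rightarrow> 'a) \<Rightarrow> nat \<Rightarrow> 'a::comm_ring_1" where
  "refl n i x =
     (if i = 0 then x(1 := 1 - x 1)
      else if i = n then x(n := - x n)
      else x(i := x (i + 1), i + 1 := x i))"

definition dot_refl :: "nat \<Rightarrow> nat \<Rightarrow> (nat \<Rightarrow> complex) \<Rightarrow> nat \<Rightarrow> complex" where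
  "dot_refl n i x = (if i = 0 then x(1 := - x 1 - 1) else refl n i x)"

text \<open>\<open>(s\<^sub>i p)(x) = p (s\<^sub>i\<^sup>-\<^sup>1 x) = p (s\<^sub>i x)\<close>, as \<open>s\<^sub>i\<close> is an involution.\<close>

definition refl_poly :: "nat \<Rightarrow> nat \<Rightarrow> cpoly \<Rightarrow> cpoly" where
  "refl_poly n i p = insertion C (refl n i X) p"

text \<open>A word \<open>[i\<^sub>1, \<dots>, i\<^sub>r]\<close> stands for the product \<open>s\<^bsub>i\<^sub>1\<^esub> \<cdots> s\<^bsub>i\<^sub>r\<^esub>\<close>.\<close>

definition words :: "nat \<Rightarrow> nat list set" where
  "words n = lists {0..n}"

definition word_elt :: "nat \<Rightarrow> nat list \<Rightarrow> (nat \<Rightarrow> complex) \<Rightarrow> nat \<Rightarrow> complex" where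
  "word_elt n ws = foldr (refl n) ws"

definition weyl :: "nat \<Rightarrow> ((nat \<Rightarrow> complex) \<Rightarrow> nat \<Rightarrow> complex) set" where
  "weyl n = word_elt n ` words n"

definition weyl_length :: "nat \<Rightarrow> ((nat \<Rightarrow> complex) \<Rightarrow> nat \<Rightarrow> complex) \<Rightarrow> nat" where
  "weyl_length n w = (LEAST r. \<exists>ws \<in> words n. word_elt n ws = w \<and> length ws = r)"

definition reduced_expr :: "nat \<Rightarrow> ((nat \<Rightarrow> complex) \<Rightarrow> nat \<Rightarrow> complex) \<Rightarrow> nat list" where
  "reduced_expr n w =
     (SOME ws. ws \<in> words n \<and> word_elt n ws = w \<and> length ws = weyl_length n w)"

text \<open>
  The dot action of a group element is given by its action along an expression in the generators;
  that the choice of expression is immaterial is \<open>dot_word_elt\<close> below.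
\<close>

definition dot :: "nat \<Rightarrow> ((nat \<Rightarrow> complex) \<Rightarrow> nat \<Rightarrow> complex) \<Rightarrow> (nat \<Rightarrow> complex) \<Rightarrow> nat \<Rightarrow> complex"
  where "dot n w = foldr (dot_refl n) (reduced_expr n w)"

definition lattice :: "nat \<Rightarrow> (nat \<Rightarrow> int) set" where
  "lattice n = {lam. \<forall>i. i \<notin> {1..n} \<longrightarrow> lam i = 0}"

text \<open>The shortest element is unique, so it does not matter which minimiser is taken.\<close>

definition u_elt :: "nat \<Rightarrow> (nat \<Rightarrow> int) \<Rightarrow> (nat \<Rightarrow> complex) \<Rightarrow> nat \<Rightarrow> complex" where
  "u_elt n lam = (ARG_MIN (weyl_length n) w.
     w \<in> weyl n \<and> dot n w (\<lambda>_. 0) = (\<lambda>i. of_int (lam i)))"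


section \<open>The operators\<close>

record params =
  par_t0 :: complex
  par_u0 :: complex
  par_t :: complex
  par_tn :: complex
  par_un :: complex

definition a_poly :: "nat \<Rightarrow> nat \<Rightarrow> cpoly" where
  "a_poly n i =
     (if i = 0 then 1 - 2 * X 1
      else if i = n then 2 * X n
      else X i - X (i + 1))"

definition chi :: "nat \<Rightarrow> params \<Rightarrow> nat \<Rightarrow> complex" where
  "chi n \<tau> i = (if i = 0 then par_t0 \<tau> else if i = n then par_tn \<tau> else 1)"

text \<open>The numerator of \<open>d\<^sub>i\<close>; its denominator is \<open>a_poly n i\<close>.\<close>

definition d_num :: "nat \<Rightarrow> params \<Rightarrow> nat \<Rightarrow> cpoly" where
  "d_num n \<tau> i =
     (if i = 0 then C ((par_t0 \<tau>)\<^sup>2 - (par_u0 \<tau>)\<^sup>2) + (C (1 / 2) - X 1)\<^sup>2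
      else if i = n then C ((par_tn \<tau>)\<^sup>2 - (par_un \<tau>)\<^sup>2) + (X n)\<^sup>2
      else C (par_t \<tau>))"

text \<open>The division is exact, see \<open>a_poly_dvd\<close> and \<open>a_poly_mult_T\<close> below.\<close>

definition T :: "nat \<Rightarrow> params \<Rightarrow> nat \<Rightarrow> cpoly \<Rightarrow> cpoly" where
  "T n \<tau> i p = C (chi n \<tau> i) * refl_poly n i p +
     exact_quot (d_num n \<tau> i * (refl_poly n i p - p)) (a_poly n i)"

text \<open>\<open>T_word n \<tau> [i\<^sub>1, \<dots>, i\<^sub>r]\<close> is the operator \<open>T\<^bsub>i\<^sub>1\<^esub> \<cdots> T\<^bsub>i\<^sub>r\<^esub>\<close>.\<close>

definition T_word :: "nat \<Rightarrow> params \<Rightarrow> nat list \<Rightarrow> cpoly \<Rightarrow> cpoly" where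
  "T_word n \<tau> ws = foldr (T n \<tau>) ws"

definition T_pair :: "nat \<Rightarrow> params \<Rightarrow> nat \<Rightarrow> nat \<Rightarrow> cpoly \<Rightarrow> cpoly" where
  "T_pair n \<tau> i j = T_word n \<tau> ([i..<j - 1] @ [j - 1] @ rev [i..<j - 1])"

definition Y :: "nat \<Rightarrow> params \<Rightarrow> nat \<Rightarrow> cpoly \<Rightarrow> cpoly" where
  "Y n \<tau> i p =
     T_word n \<tau> ([i..<n] @ [n] @ rev [i..<n]) p +
     T_word n \<tau> (rev [1..<i] @ [0] @ [1..<i]) p +
     C (par_t \<tau>) * (\<Sum>j = i + 1..n. T_pair n \<tau> i j p)"

text \<open>
  \<open>poly_Y n \<tau> f\<close> is \<open>f(Y) = f(Y\<^sub>1, \<dots>, Y\<^sub>n)\<close> for \<open>f \<in> polys n\<close>.  The powers of the (commuting)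
  operators are composed in the order \<open>Y\<^sub>1\<^bsup>m\<^sub>1\<^esup> \<cdots> Y\<^sub>n\<^bsup>m\<^sub>n\<^esup>\<close>.
\<close>

definition poly_Y :: "nat \<Rightarrow> params \<Rightarrow> cpoly \<Rightarrow> cpoly \<Rightarrow> cpoly" where
  "poly_Y n \<tau> f p = (\<Sum>m \<in> Poly_Mapping.keys f.
     C (Poly_Mapping.lookup f m) *
     foldr (\<lambda>i. Y n \<tau> i ^^ Poly_Mapping.lookup m i) [1..<n + 1] p)"

definition U :: "nat \<Rightarrow> params \<Rightarrow> cpoly \<Rightarrow> cpoly" where
  "U n \<tau> p = T_word n \<tau> [1..<n]
     ((\<lambda>q. - (X n * q) - T n \<tau> n q) (T_word n \<tau> (rev [1..<n]) p))"

definition commutator :: "(cpoly \<Rightarrow> cpoly) \<Rightarrow> (cpoly \<Rightarrow> cpoly) \<Rightarrow> cpoly \<Rightarrow> cpoly" where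
  "commutator A B p = A (B p) - B (A p)"

definition S :: "nat \<Rightarrow> params \<Rightarrow> nat \<Rightarrow> cpoly \<Rightarrow> cpoly" where
  "S n \<tau> i = commutator (if i = 0 then U n \<tau> else T n \<tau> i) (poly_Y n \<tau> (a_poly n i))"

text \<open>By the braid relations for the \<open>S\<^sub>i\<close>, this is independent of the reduced expression.\<close>

definition S_elt :: "nat \<Rightarrow> params \<Rightarrow> ((nat \<Rightarrow> complex) \<Rightarrow> nat \<Rightarrow> complex) \<Rightarrow> cpoly \<Rightarrow> cpoly" where
  "S_elt n \<tau> w = foldr (S n \<tau>) (reduced_expr n w)"

definition wilson_poly :: "nat \<Rightarrow> params \<Rightarrow> (nat \<Rightarrow> int) \<Rightarrow> cpoly" where
  "wilson_poly n \<tau> lam = S_elt n \<tau> (u_elt n lam) 1"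

definition gamma0 :: "nat \<Rightarrow> params \<Rightarrow> nat \<Rightarrow> complex" where
  "gamma0 n \<tau> i =
     (if i \<in> {1..n} then par_t0 \<tau> + par_tn \<tau> + of_nat (n - i) * par_t \<tau> else 0)"

definition gamma :: "nat \<Rightarrow> params \<Rightarrow> (nat \<Rightarrow> int) \<Rightarrow> nat \<Rightarrow> complex" where
  "gamma n \<tau> lam = dot n (u_elt n lam) (gamma0 n \<tau>)"


section \<open>Well-definedness of the quotient and of the dot action\<close>

lemma reduced_expr:
  assumes "w \<in> weyl n"
  shows "reduced_expr n w \<in> words n" "word_elt n (reduced_expr n w) = w"
    "length (reduced_expr n w) = weyl_length n w"
proof -
  have "\<exists>r. \<exists>ws \<in> words n. word_elt n ws = w \<and> length ws = r"
    using assms by (auto simp: weyl_def)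
  from LeastI_ex[OF this]
  have "\<exists>ws. ws \<in> words n \<and> word_elt n ws = w \<and> length ws = weyl_length n w"
    unfolding weyl_length_def by blast
  from someI_ex[OF this]
  show "reduced_expr n w \<in> words n" "word_elt n (reduced_expr n w) = w"
    "length (reduced_expr n w) = weyl_length n w"
    unfolding reduced_expr_def by auto
qed

lemma foldr_dot_refl:
  "foldr (dot_refl n) ws x = (\<lambda>i. - word_elt n ws (\<lambda>i. - x i) i)"
proof (induction ws)
  case Nil
  then show ?case by (simp add: word_elt_def)
next
  case (Cons k ws)
  show ?case
    unfolding foldr_Cons comp_apply Cons word_elt_def
    by (auto simp: dot_refl_def refl_def fun_eq_iff)
qed

lemma dot_word_elt:
  assumes "ws \<in> words n"
  shows "dot n (word_elt n ws) = foldr (dot_refl n) ws"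
proof -
  have "word_elt n ws \<in> weyl n"
    using assms by (simp add: weyl_def)
  then show ?thesis
    unfolding dot_def by (intro ext) (simp add: foldr_dot_refl reduced_expr(2))
qed

lemma poly_expansion: "insertion C X p = p"
proof -
  have mon: "(\<Prod>i \<in> A. X i ^ Poly_Mapping.lookup m i) =
      Poly_Mapping.single (\<Sum>i \<in> A. Poly_Mapping.single i (Poly_Mapping.lookup m i)) 1"
    if "finite A" for A and m :: "nat \<Rightarrow>\<^sub>0 nat"
  proof -
    have pw: "X i ^ k = Poly_Mapping.single (Poly_Mapping.single i k) 1" for i k
      by (induction k) (auto simp: X_def mult_single single_add [symmetric])
    show ?thesis
      using that by (induction A) (auto simp: pw mult_single)
  qed
  have expo: "(\<Sum>i \<in> Poly_Mapping.keys m. Poly_Mapping.single i (Poly_Mapping.lookup m i)) = m"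
    for m :: "nat \<Rightarrow>\<^sub>0 'b::comm_monoid_add"
    by (rule poly_mapping_eqI)
      (auto simp: lookup_sum lookup_single when_def sum.delta in_keys_iff)
  have expo': "(\<Sum>m \<in> Poly_Mapping.keys p. Poly_Mapping.single m (Poly_Mapping.lookup p m)) = p"
    by (rule poly_mapping_eqI)
      (auto simp: lookup_sum lookup_single when_def sum.delta in_keys_iff)
  show ?thesis
    unfolding insertion_def by (simp add: mon expo C_def mult_single expo')
qed

lemma dvd_prod_diff:
  fixes a :: "'a::comm_ring_1"
  assumes "finite A" "\<And>i. i \<in> A \<Longrightarrow> a dvd f i - g i"
  shows "a dvd prod f A - prod g A"
  using assms
proof (induction A rule: finite_induct)
  case empty
  then show ?case by simp
next
  case (insert i A)
  have "f i * prod f A - g i * prod g A =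
      (f i - g i) * prod f A + g i * (prod f A - prod g A)"
    by (simp add: algebra_simps)
  moreover have "a dvd f i - g i" "a dvd prod f A - prod g A"
    using insert by auto
  ultimately show ?case
    using insert by (simp add: dvd_add)
qed

lemma a_poly_dvd: "a_poly n i dvd refl_poly n i p - p"
proof -
  let ?a = "a_poly n i"
  have gen: "?a dvd refl n i X k - X k" for k
  proof -
    have "\<exists>c. refl n i X k - X k = ?a * c"
    proof (cases "refl n i X k = X k")
      case True
      then show ?thesis by (intro exI[of _ 0]) simp
    next
      case False
      consider "i = 0" "k = 1" | "i \<noteq> 0" "i = n" "k = n" | "i \<noteq> 0" "i \<noteq> n" "k = i"
        | "i \<noteq> 0" "i \<noteq> n" "k = i + 1"
        using False by (auto simp: refl_def split: if_splits)
      then show ?thesis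
      proof cases
        case 1
        then show ?thesis by (intro exI[of _ 1]) (simp add: refl_def a_poly_def)
      next
        case 2
        then show ?thesis by (intro exI[of _ "- 1"]) (simp add: refl_def a_poly_def)
      next
        case 3
        then show ?thesis by (intro exI[of _ "- 1"]) (simp add: refl_def a_poly_def)
      next
        case 4
        then show ?thesis by (intro exI[of _ 1]) (simp add: refl_def a_poly_def)
      qed
    qed
    then show ?thesis by (auto simp: dvd_def)
  qed
  have pow: "?a dvd refl n i X k ^ e - X k ^ e" for k e
    using dvd_prod_diff[of "{..<e}" ?a "\<lambda>_. refl n i X k" "\<lambda>_. X k"] gen by simp
  have "?a dvd insertion C (refl n i X) p - insertion C X p"
    unfolding insertion_def sum_subtractf [symmetric] right_diff_distrib [symmetric]
    by (intro dvd_sum dvd_mult dvd_prod_diff pow) auto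
  then show ?thesis
    by (simp add: refl_poly_def poly_expansion)
qed

lemma a_poly_nonzero: "a_poly n i \<noteq> 0"
proof -
  have ne: "Poly_Mapping.single i (1::nat) \<noteq> 0" "0 \<noteq> Poly_Mapping.single i (1::nat)" for i :: nat
    by (metis lookup_single_eq lookup_zero zero_neq_one)+
  have inj: "Poly_Mapping.single i (1::nat) = Poly_Mapping.single j 1 \<longleftrightarrow> i = j" for i j :: nat
    by (metis lookup_single_eq lookup_single_not_eq zero_neq_one)
  have two: "Poly_Mapping.lookup (2 * p) m = 2 * Poly_Mapping.lookup p m" for p :: cpoly and m
    by (simp only: mult_2 lookup_add)
  have "Poly_Mapping.lookup (a_poly n i) (Poly_Mapping.single (if i = 0 then 1 else i) 1) \<noteq> 0"
    using ne inj
    by (auto simp: a_poly_def lookup_minus lookup_add two X_def lookup_one lookup_single when_def)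
  then show ?thesis by (metis lookup_zero)
qed

lemma exact_quot:
  assumes "a \<noteq> 0" "a dvd p"
  shows "a * exact_quot p a = p"
proof -
  from assms(2) obtain q where q: "a * q = p" by (auto simp: dvd_def)
  with assms(1) have "exact_quot p a = q"
    unfolding exact_quot_def by (intro the_equality) auto
  with q show ?thesis by simp
qed

lemma a_poly_mult_T:
  "a_poly n i * T n \<tau> i p =
     a_poly n i * C (chi n \<tau> i) * refl_poly n i p + d_num n \<tau> i * (refl_poly n i p - p)"
proof -
  have "a_poly n i * exact_quot (d_num n \<tau> i * (refl_poly n i p - p)) (a_poly n i) =
      d_num n \<tau> i * (refl_poly n i p - p)"
    by (intro exact_quot a_poly_nonzero dvd_mult a_poly_dvd)
  then show ?thesis
    by (simp add: T_def distrib_left mult.assoc)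
qed

end

theory Submission
  imports Defs
begin

text \<open>
  Apart from \<open>T\<^sub>i\<^sup>2 = \<chi>\<^sub>i\<^sup>2\<close> and the type \<open>A\<close> braid relations, the \<open>T\<^sub>i\<close> satisfy a degenerate
  reflection equation at either end of the diagram:
  \<open>F = T\<^sub>0\<close>, \<open>G = T\<^sub>1\<close>, as well as \<open>F = T\<^sub>n\<close>, \<open>G = T\<^bsub>n-1\<^esub>\<close>, satisfy \<open>[F, G F G + t G] = 0\<close>.
  Each relation has the form \<open>E = 0\<close> with \<open>E 1 = 0\<close> and \<open>E x\<^sub>k = q E\<close> for some polynomial \<open>q\<close>, so it
  follows by induction on the polynomial.  Since \<open>Y\<^sub>i = T\<^sub>i Y\<^bsub>i+1\<^esub> T\<^sub>i + t T\<^sub>i\<close>, the \<open>Y\<^sub>i\<close> commute as soon as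
  \<open>Y\<^bsub>n-1\<^esub>\<close> and \<open>Y\<^sub>n\<close> do, which is the reflection equations.

  For \<open>0 < i < n\<close> the intertwining property of \<open>S\<^sub>i\<close> is the usual one.  For the end nodes, if \<open>P\<^sup>2\<close> and
  \<open>Q\<^sup>2\<close> are scalars then \<open>[P, Q]\<close> anticommutes with \<open>P\<close> and \<open>Q\<close>; this applies to
  \<open>Y\<^sub>n = T\<^sub>n + T\<^bsub>n-1\<^esub> \<cdots> T\<^sub>0 \<cdots> T\<^bsub>n-1\<^esub>\<close> and to \<open>Y\<^sub>1 + 1/2 = (T\<^sub>0 - X\<^sub>1 + 1/2) - U\<^sub>n\<close>.
  Hence each \<open>S\<^sub>i\<close> maps a joint eigenvector of the \<open>Y\<^sub>j\<close> to one with the eigenvalues transformed by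
  the dot action of \<open>s\<^sub>i\<close>, and one starts from \<open>1\<close>, whose eigenvalues are \<open>\<gamma>\<^sub>0\<close>.
\<close>

section \<open>Evaluation and induction on polynomials\<close>

lemma C_simps: "C 0 = 0" "C 1 = 1" "C (a + b) = C a + C b" "C (a * b) = C a * C b"
  "C (- a) = - C a" "C (a - b) = C a - C b" "C (numeral w) = numeral w"
  "C (a ^ k) = C a ^ k" "C (of_nat k) = of_nat k"
proof -
  show 0: "C 0 = 0" "C 1 = 1" by (simp_all add: C_def)
  show add: "C (a + b) = C a + C b" for a b by (simp add: C_def single_add)
  show mult: "C (a * b) = C a * C b" for a b by (simp add: C_def mult_single)
  show m: "C (- a) = - C a" for a by (simp add: C_def single_uminus)
  show "C (a - b) = C a - C b" using add[of a "- b"] m by simp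
  show "C (of_nat k) = of_nat k" for k by (induction k) (simp_all add: 0 add)
  from this[of "numeral w"] show "C (numeral w) = numeral w" by simp
  show "C (a ^ k) = C a ^ k" by (induction k) (simp_all add: 0 mult)
qed

lemma insertion_superset:
  assumes "finite K" "Poly_Mapping.keys p \<subseteq> K" "h 0 = 0"
  shows "insertion h x p = (\<Sum>m \<in> K.
     h (Poly_Mapping.lookup p m) * (\<Prod>i \<in> Poly_Mapping.keys m. x i ^ Poly_Mapping.lookup m i))"
  unfolding insertion_def using assms
  by (intro sum.mono_neutral_left) (auto simp: in_keys_iff)

lemma insertion_add:
  assumes "\<And>a b. h (a + b) = h a + h b" "h 0 = 0"
  shows "insertion h x (p + q) = insertion h x p + insertion h x q"
  by (subst (1 2 3) insertion_superset[of "Poly_Mapping.keys p \<union> Poly_Mapping.keys q"])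
    (use assms Poly_Mapping.keys_add[of p q] in \<open>auto simp: lookup_add distrib_right sum.distrib\<close>)

lemma cpoly_induct [case_names C add X]:
  assumes "\<And>c. P (C c)" "\<And>p q. P p \<Longrightarrow> P q \<Longrightarrow> P (p + q)" "\<And>k p. P p \<Longrightarrow> P (X k * p)"
  shows "P p"
proof -
  have pow: "P (X k ^ e * q)" if "P q" for k e q
    using that by (induction e) (auto simp: assms(3) mult.assoc)
  have mon: "P (c * (\<Prod>i \<in> A. X i ^ f i))" if "finite A" "P c" for A f c
    using that by (induction A) (simp_all add: pow mult.left_commute[of c])
  have "P (\<Sum>m \<in> M. f m)" if "finite M" "\<And>m. m \<in> M \<Longrightarrow> P (f m)" for M and f :: "(nat \<Rightarrow>\<^sub>0 nat) \<Rightarrow> cpoly"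
    using that assms(1)[of 0] by (induction M) (auto simp: assms(2) C_simps)
  from this[OF finite_keys mon[OF finite_keys assms(1)]] have "P (insertion C X p)"
    unfolding insertion_def .
  then show ?thesis by (simp add: poly_expansion)
qed

lemma cpoly_single_induct [case_names single add]:
  assumes "\<And>m c. P (Poly_Mapping.single m c)" "\<And>p q. P p \<Longrightarrow> P q \<Longrightarrow> P (p + q)"
  shows "P (p :: cpoly)"
proof -
  have "P (\<Sum>m \<in> M. Poly_Mapping.single m (f m))" if "finite M" for M and f :: "(nat \<Rightarrow>\<^sub>0 nat) \<Rightarrow> complex"
    using that assms(1)[of 0 0] by (induction M) (auto intro: assms)
  moreover have "p = (\<Sum>m \<in> Poly_Mapping.keys p. Poly_Mapping.single m (Poly_Mapping.lookup p m))"
    by (rule poly_mapping_eqI)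
      (auto simp: lookup_sum lookup_single when_def sum.delta in_keys_iff)
  ultimately show ?thesis by (metis finite_keys)
qed

lemma insertion_single:
  assumes "h 0 = 0"
  shows "insertion h x (Poly_Mapping.single m c) = h c * (\<Prod>i \<in> Poly_Mapping.keys m. x i ^ Poly_Mapping.lookup m i)"
  using assms by (simp add: insertion_def)

lemma prod_superset:
  fixes x :: "nat \<Rightarrow> 'a::comm_ring_1"
  assumes "finite K" "Poly_Mapping.keys m \<subseteq> K"
  shows "(\<Prod>i \<in> Poly_Mapping.keys m. x i ^ Poly_Mapping.lookup m i) = (\<Prod>i \<in> K. x i ^ Poly_Mapping.lookup m i)"
  using assms by (intro prod.mono_neutral_left) (auto simp: in_keys_iff)

lemma insertion_X_mult:
  assumes "\<And>a b. h (a + b) = h a + h b" "h 0 = 0"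
  shows "insertion h x (X k * p) = x k * insertion h x p"
proof (induction p rule: cpoly_single_induct)
  case (single m c)
  let ?K = "insert k (Poly_Mapping.keys m)"
  have "(\<Prod>i \<in> Poly_Mapping.keys (Poly_Mapping.single k 1 + m). x i ^ Poly_Mapping.lookup (Poly_Mapping.single k 1 + m) i)
      = (\<Prod>i \<in> ?K. x i ^ Poly_Mapping.lookup (Poly_Mapping.single k 1 + m) i)"
    using Poly_Mapping.keys_add[of "Poly_Mapping.single k 1" m]
    by (intro prod_superset) (auto split: if_splits)
  also have "\<dots> = (\<Prod>i \<in> ?K. (if i = k then x i else 1) * x i ^ Poly_Mapping.lookup m i)"
    by (intro prod.cong) (auto simp: lookup_add lookup_single when_def power_add)
  also have "\<dots> = x k * (\<Prod>i \<in> ?K. x i ^ Poly_Mapping.lookup m i)"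
    by (subst prod.distrib) (simp add: prod.delta)
  also have "(\<Prod>i \<in> ?K. x i ^ Poly_Mapping.lookup m i) = (\<Prod>i \<in> Poly_Mapping.keys m. x i ^ Poly_Mapping.lookup m i)"
    by (rule prod_superset [symmetric]) auto
  finally show ?case
    using assms by (simp add: X_def mult_single insertion_single)
next
  case (add p q)
  then show ?case using assms by (simp add: insertion_add distrib_left)
qed

lemma insertion_C_mult:
  "insertion C x (C c * p) = C c * insertion C x p"
proof (induction p rule: cpoly_single_induct)
  case (single m d)
  then show ?case by (simp add: C_def mult_single insertion_single mult.assoc[symmetric])
next
  case (add p q)
  then show ?case by (simp add: insertion_add distrib_left C_simps)
qed

lemma refl_poly_add: "refl_poly n i (p + q) = refl_poly n i p + refl_poly n i q"
  by (simp add: refl_poly_def insertion_add C_simps)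

lemma refl_poly_C_mult: "refl_poly n i (C c * p) = C c * refl_poly n i p"
  by (simp add: refl_poly_def insertion_C_mult)

lemma refl_poly_X_mult: "refl_poly n i (X k * p) = refl n i X k * refl_poly n i p"
  by (simp add: refl_poly_def insertion_X_mult C_simps)

lemma refl_poly_1: "refl_poly n i 1 = 1"
  using insertion_single[of C "refl n i X" 0 1] by (simp add: refl_poly_def C_simps)

lemma T_eqI: "a_poly n i * q = a_poly n i * C (chi n \<tau> i) * refl_poly n i p + d_num n \<tau> i * (refl_poly n i p - p)
    \<Longrightarrow> T n \<tau> i p = q"
  by (metis a_poly_mult_T a_poly_nonzero mult_left_cancel)

lemma T_add: "T n \<tau> i (p + q) = T n \<tau> i p + T n \<tau> i q"
  by (rule T_eqI) (simp add: distrib_left a_poly_mult_T refl_poly_add algebra_simps)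

lemma T_C_mult: "T n \<tau> i (C c * p) = C c * T n \<tau> i p"
proof (rule T_eqI)
  have "a_poly n i * (C c * T n \<tau> i p) = C c * (a_poly n i * T n \<tau> i p)" by (simp add: algebra_simps)
  then show "a_poly n i * (C c * T n \<tau> i p) = a_poly n i * C (chi n \<tau> i) * refl_poly n i (C c * p) +
      d_num n \<tau> i * (refl_poly n i (C c * p) - C c * p)"
    unfolding a_poly_mult_T refl_poly_C_mult by (simp add: algebra_simps)
qed

lemma T_1: "T n \<tau> i 1 = C (chi n \<tau> i)"
  by (rule T_eqI) (simp add: refl_poly_1)

lemma T_X_mult:
  assumes "refl n i X k - X k = a_poly n i * r"
  shows "T n \<tau> i (X k * p) = refl n i X k * T n \<tau> i p + d_num n \<tau> i * (r * p)"
proof (rule T_eqI)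
  have "a_poly n i * (refl n i X k * T n \<tau> i p + d_num n \<tau> i * (r * p)) =
     refl n i X k * (a_poly n i * T n \<tau> i p) + d_num n \<tau> i * ((a_poly n i * r) * p)" by (simp add: algebra_simps)
  then show "a_poly n i * (refl n i X k * T n \<tau> i p + d_num n \<tau> i * (r * p)) =
      a_poly n i * C (chi n \<tau> i) * refl_poly n i (X k * p) +
      d_num n \<tau> i * (refl_poly n i (X k * p) - X k * p)"
    unfolding a_poly_mult_T refl_poly_X_mult assms[symmetric] by (simp add: algebra_simps)
qed

section \<open>Relations between the operators \<open>T\<^sub>i\<close>\<close>

definition linear_op :: "(cpoly \<Rightarrow> cpoly) \<Rightarrow> bool" where
  "linear_op F \<longleftrightarrow> (\<forall>p q. F (p + q) = F p + F q) \<and> (\<forall>c p. F (C c * p) = C c * F p)"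

lemma linear_opD:
  assumes "linear_op F"
  shows "F (p + q) = F p + F q" "F (C c * p) = C c * F p" "F (p * C c) = F p * C c"
    "F (- p) = - F p" "F (p - q) = F p - F q" "F 0 = 0"
    "F (numeral w * p) = numeral w * F p" "F (p * numeral w) = F p * numeral w"
proof -
  show add: "F (p + q) = F p + F q" for p q using assms by (simp add: linear_op_def)
  show sc: "F (C c * p) = C c * F p" for c p using assms by (simp add: linear_op_def)
  show "F (p * C c) = F p * C c" using sc by (simp add: mult.commute)
  show m: "F (- p) = - F p" for p using sc[of "- 1" p] by (simp add: C_simps)
  show "F (p - q) = F p - F q" using add[of p "- q"] m by simp
  show "F 0 = 0" using sc[of 0 0] by (simp add: C_simps)
  show num: "F (numeral w * p) = numeral w * F p" for p using sc[of "numeral w" p] by (simp add: C_simps)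
  then show "F (p * numeral w) = F p * numeral w" by (simp add: mult.commute)
qed

lemma linear_op_T: "linear_op (T n \<tau> i)"
  by (simp add: linear_op_def T_add T_C_mult)

lemmas T_linear = linear_opD[OF linear_op_T]

lemma T_X_middle:
  assumes "1 \<le> i" "i < n"
  shows "T n \<tau> i (X i * p) = X (i + 1) * T n \<tau> i p - C (par_t \<tau>) * p"
    "T n \<tau> i (X (i + 1) * p) = X i * T n \<tau> i p + C (par_t \<tau>) * p"
  using T_X_mult[of n i i "-1" \<tau> p] T_X_mult[of n i "i + 1" 1 \<tau> p] assms
  by (simp_all add: refl_def a_poly_def d_num_def)

lemma T_X_last:
  assumes "n \<noteq> 0"
  shows "T n \<tau> n (X n * p) = - (X n * T n \<tau> n p) - (C ((par_tn \<tau>)\<^sup>2 - (par_un \<tau>)\<^sup>2) + (X n)\<^sup>2) * p"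
  using assms by (subst T_X_mult[where r = "- 1"]) (simp_all add: refl_def a_poly_def d_num_def algebra_simps)

lemma C_half: "C (1 / 2) * p + C (1 / 2) * p = p"
  by (simp add: distrib_right [symmetric] C_simps(3) [symmetric] C_simps(2))

lemma T_X_first:
  "T n \<tau> 0 (X 1 * p) = T n \<tau> 0 p - X 1 * T n \<tau> 0 p +
     (C ((par_t0 \<tau>)\<^sup>2 - (par_u0 \<tau>)\<^sup>2 + 1 / 4) - X 1 + (X 1)\<^sup>2) * p"
proof -
  have "d_num n \<tau> 0 = C ((par_t0 \<tau>)\<^sup>2 - (par_u0 \<tau>)\<^sup>2 + 1 / 4) - X 1 + (X 1)\<^sup>2"
    using C_half[of "X 1"] C_simps(4)[of "1 / 2" "1 / 2"] C_simps(3)[of "(par_t0 \<tau>)\<^sup>2 - (par_u0 \<tau>)\<^sup>2" "1 / 4"]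
    by (simp add: d_num_def power2_eq_square algebra_simps)
  moreover have "T n \<tau> 0 (X 1 * p) = T n \<tau> 0 p - X 1 * T n \<tau> 0 p + d_num n \<tau> 0 * p"
    by (subst T_X_mult[where r = 1]) (simp_all add: refl_def a_poly_def left_diff_distrib)
  ultimately show ?thesis by simp
qed

lemma T_half_first:
  "T n \<tau> 0 ((C (1 / 2) - X 1) * p) = - ((C (1 / 2) - X 1) * T n \<tau> 0 p) -
     (C ((par_t0 \<tau>)\<^sup>2 - (par_u0 \<tau>)\<^sup>2) + (C (1 / 2) - X 1)\<^sup>2) * p"
proof -
  have "T n \<tau> 0 (X 1 * p) = T n \<tau> 0 p - X 1 * T n \<tau> 0 p + (C ((par_t0 \<tau>)\<^sup>2 - (par_u0 \<tau>)\<^sup>2) + (C (1 / 2) - X 1)\<^sup>2) * p"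
    by (subst T_X_mult[where r = 1]) (simp_all add: refl_def a_poly_def d_num_def left_diff_distrib)
  then show ?thesis
    using C_half[of "T n \<tau> 0 p"]
    by (simp add: left_diff_distrib T_linear algebra_simps)
qed

lemma T_X_other:
  assumes "refl n i X k = X k"
  shows "T n \<tau> i (X k * p) = X k * T n \<tau> i p"
  using T_X_mult[of n i k 0 \<tau> p] assms by simp

lemma linear_op_eqI:
  assumes "linear_op F" "linear_op G" "F 1 = G 1"
    and "\<And>k p. F p = G p \<Longrightarrow> F (X k * p) = G (X k * p)"
  shows "F p = G p"
proof (induction p rule: cpoly_induct)
  case (C c)
  then show ?case using assms(3) linear_opD(2)[OF assms(1), of c 1] linear_opD(2)[OF assms(2), of c 1] by simp
next
  case (add p q)
  then show ?case by (simp add: linear_opD[OF assms(1)] linear_opD[OF assms(2)])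
next
  case (X k p)
  then show ?case by (rule assms(4))
qed

lemma linear_op_comp: "linear_op F \<Longrightarrow> linear_op G \<Longrightarrow> linear_op (\<lambda>p. F (G p))"
  and linear_op_add: "linear_op F \<Longrightarrow> linear_op G \<Longrightarrow> linear_op (\<lambda>p. F p + G p)"
  and linear_op_diff: "linear_op F \<Longrightarrow> linear_op G \<Longrightarrow> linear_op (\<lambda>p. F p - G p)"
  and linear_op_uminus: "linear_op F \<Longrightarrow> linear_op (\<lambda>p. - F p)"
  and linear_op_mult: "linear_op F \<Longrightarrow> linear_op (\<lambda>p. q * F p)"
  and linear_op_id: "linear_op (\<lambda>p. p)"
  by (simp_all add: linear_op_def distrib_left right_diff_distrib mult.left_commute)

lemmas linear_op_intros = linear_op_T linear_op_comp[OF linear_op_T] linear_op_add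
  linear_op_diff linear_op_mult linear_op_uminus linear_op_id

lemmas op_expand = distrib_left distrib_right left_diff_distrib right_diff_distrib power2_eq_square mult.assoc

lemma T_square:
  assumes "n \<ge> 2" "i \<le> n"
  shows "T n \<tau> i (T n \<tau> i p) = C ((chi n \<tau> i)\<^sup>2) * p"
proof (rule linear_op_eqI[where p = p])
  show "linear_op (\<lambda>p. T n \<tau> i (T n \<tau> i p))" "linear_op (\<lambda>p. C ((chi n \<tau> i)\<^sup>2) * p)"
    by (intro linear_op_intros)+
  show "T n \<tau> i (T n \<tau> i 1) = C ((chi n \<tau> i)\<^sup>2) * 1"
    using T_C_mult[of n \<tau> i "chi n \<tau> i" 1] by (simp add: T_1 C_simps power2_eq_square)
  fix k p assume IH: "T n \<tau> i (T n \<tau> i p) = C ((chi n \<tau> i)\<^sup>2) * p"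
  have "refl n i X k = X k \<or> i = 0 \<and> k = 1 \<or> i = n \<and> k = n \<or> 1 \<le> i \<and> i < n \<and> (k = i \<or> k = i + 1)"
    using assms by (auto simp: refl_def)
  then consider "i = 0" "k = 1" | "i = n" "k = n" | "1 \<le> i" "i < n" "k = i"
    | "1 \<le> i" "i < n" "k = i + 1" | "refl n i X k = X k"
    by blast
  then show "T n \<tau> i (T n \<tau> i (X k * p)) = C ((chi n \<tau> i)\<^sup>2) * (X k * p)"
  proof cases
    case 1
    then show ?thesis using assms IH
      by (simp add: T_X_first[simplified] T_linear op_expand)
  next
    case 2
    then show ?thesis using assms IH
      by (simp add: T_X_last T_linear op_expand)
  next
    case 3
    then show ?thesis using IH
      by (simp add: T_X_middle[simplified] T_linear op_expand)
  next
    case 4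
    then show ?thesis using IH
      by (simp add: T_X_middle[simplified] T_linear op_expand)
  next
    case 5
    then show ?thesis using IH
      by (simp add: T_X_other mult.left_commute)
  qed
qed

text \<open>The hypotheses describe \<open>T\<^sub>n, T\<^bsub>n-1\<^esub>\<close> with \<open>x = x\<^bsub>n-1\<^esub>\<close>, \<open>y = x\<^sub>n\<close>, and also
  \<open>T\<^sub>0, T\<^sub>1\<close> with \<open>x = 1/2 - x\<^sub>2\<close>, \<open>y = 1/2 - x\<^sub>1\<close>.\<close>
lemma reflection_equation_mult:
  assumes F: "linear_op F" and G: "linear_op G"
    and sq: "\<And>p. F (F p) = C c * p" "\<And>p. G (G p) = p"
    and GX: "\<And>p. G (y * p) = x * G p + C t * p" "\<And>p. G (x * p) = y * G p - C t * p"
    and FX: "\<And>p. F (y * p) = - (y * F p) - (C k + y\<^sup>2) * p" "\<And>p. F (x * p) = x * F p"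
  defines "E \<equiv> \<lambda>p. F (G (F (G p))) + C t * F (G p) - G (F (G (F p))) - C t * G (F p)"
  shows "E (y * p) = - (y * E p)" "E (x * p) = - (x * E p)"
proof -
  show "E (y * p) = - (y * E p)"
    unfolding E_def
    by (simp add: linear_opD[OF F] linear_opD[OF G] sq GX FX op_expand)
  show "E (x * p) = - (x * E p)"
    unfolding E_def
    by (simp add: linear_opD[OF F] linear_opD[OF G] sq GX FX op_expand)
qed

lemma T_C: "T n \<tau> i (C c) = C c * C (chi n \<tau> i)"
  using T_C_mult[of n \<tau> i c 1] by (simp add: T_1)

lemma T_square_middle:
  assumes "1 \<le> i" "i < n"
  shows "T n \<tau> i (T n \<tau> i p) = p"
  using T_square[of n i \<tau> p] assms by (simp add: chi_def C_simps(2))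

lemma reflection_equation_last:
  fixes \<tau> :: params
  assumes "n \<ge> 2"
  defines "F \<equiv> T n \<tau> n" and "G \<equiv> T n \<tau> (n - 1)"
  shows "F (G (F (G p))) + C (par_t \<tau>) * F (G p) = G (F (G (F p))) + C (par_t \<tau>) * G (F p)"
proof -
  let ?E = "\<lambda>p. F (G (F (G p))) + C (par_t \<tau>) * F (G p) - G (F (G (F p))) - C (par_t \<tau>) * G (F p)"
  have n: "Suc (n - Suc 0) = n" "n - Suc 0 \<noteq> n" using assms(1) by auto
  have FG: "linear_op F" "linear_op G" "F (F p) = C ((chi n \<tau> n)\<^sup>2) * p" "G (G p) = p"
    "G (X n * p) = X (n - 1) * G p + C (par_t \<tau>) * p" "G (X (n - 1) * p) = X n * G p - C (par_t \<tau>) * p"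
    "F (X n * p) = - (X n * F p) - (C ((par_tn \<tau>)\<^sup>2 - (par_un \<tau>)\<^sup>2) + (X n)\<^sup>2) * p"
    "F (X (n - 1) * p) = X (n - 1) * F p" for p
    using assms(1) n T_X_middle[of "n - 1" n \<tau>] T_X_other[of n n "n - 1"]
    by (simp_all add: F_def G_def linear_op_T T_square[of n n] T_square_middle T_X_last refl_def)
  note mult = reflection_equation_mult[OF FG]
  have other: "?E (X k * p) = X k * ?E p" if "k \<noteq> n" "k \<noteq> n - 1" for k p
    using that n assms(1)
    by (simp add: F_def G_def T_X_other refl_def right_diff_distrib distrib_left mult.left_commute[of "X k"])
  have "?E p = 0"
  proof (rule linear_op_eqI[where p = p and G = "\<lambda>_. 0"])
    show "linear_op ?E" unfolding F_def G_def by (intro linear_op_intros)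
    show "linear_op (\<lambda>_. 0)" by (simp add: linear_op_def)
    show "?E 1 = 0"
      by (simp add: F_def G_def T_1 T_C T_C_mult T_linear mult.assoc)
    show "?E (X k * q) = 0" if "?E q = 0" for k q
      by (cases "k = n"; cases "k = n - 1") (simp_all only: mult other that not_False_eq_True mult_zero_right minus_zero)
  qed
  then show ?thesis by (simp add: algebra_simps)
qed

lemma reflection_equation_first:
  fixes \<tau> :: params
  assumes "n \<ge> 2"
  defines "F \<equiv> T n \<tau> 0" and "G \<equiv> T n \<tau> 1"
  shows "F (G (F (G p))) + C (par_t \<tau>) * F (G p) = G (F (G (F p))) + C (par_t \<tau>) * G (F p)"
proof -
  let ?E = "\<lambda>p. F (G (F (G p))) + C (par_t \<tau>) * F (G p) - G (F (G (F p))) - C (par_t \<tau>) * G (F p)"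
  have lin: "linear_op ?E" unfolding F_def G_def by (intro linear_op_intros)
  have FG: "linear_op F" "linear_op G" "F (F p) = C ((chi n \<tau> 0)\<^sup>2) * p" "G (G p) = p"
    "G ((C (1 / 2) - X 1) * p) = (C (1 / 2) - X 2) * G p + C (par_t \<tau>) * p"
    "G ((C (1 / 2) - X 2) * p) = (C (1 / 2) - X 1) * G p - C (par_t \<tau>) * p"
    "F ((C (1 / 2) - X 1) * p) = - ((C (1 / 2) - X 1) * F p) -
       (C ((par_t0 \<tau>)\<^sup>2 - (par_u0 \<tau>)\<^sup>2) + (C (1 / 2) - X 1)\<^sup>2) * p"
    "F ((C (1 / 2) - X 2) * p) = (C (1 / 2) - X 2) * F p" for p
    using assms(1) T_X_middle[of 1 n \<tau>]
    by (simp_all only: F_def G_def T_half_first)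
      (simp_all add: linear_op_T T_square[of n 0] T_square_middle T_linear left_diff_distrib
        T_X_other refl_def numeral_2_eq_2)
  note half = reflection_equation_mult[OF FG]
  have shift: "H (x * p) = (1 - x) * H p"
    if "linear_op H" "H ((C (1 / 2) - x) * p) = - ((C (1 / 2) - x) * H p)" for H x p
    using that(2) C_half[of "H p"] by (simp add: left_diff_distrib linear_opD[OF that(1)] algebra_simps)
  have mult: "?E (X 1 * p) = (1 - X 1) * ?E p" "?E (X 2 * p) = (1 - X 2) * ?E p" for p
    using shift[OF lin half(1)] shift[OF lin half(2)] .
  have other: "?E (X k * p) = X k * ?E p" if "k \<notin> {1, 2}" for k p
    using that assms(1)
    by (simp add: F_def G_def T_X_other refl_def right_diff_distrib distrib_left mult.left_commute[of "X k"])
  have "?E p = 0"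
  proof (rule linear_op_eqI[where p = p and G = "\<lambda>_. 0"])
    show "linear_op ?E" by (rule lin)
    show "linear_op (\<lambda>_. 0)" by (simp add: linear_op_def)
    show "?E 1 = 0"
      by (simp add: F_def G_def T_1 T_C T_C_mult T_linear mult.assoc)
    show "?E (X k * q) = 0" if "?E q = 0" for k q
      by (cases "k = 1"; cases "k = 2") (simp_all only: mult other that insert_iff empty_iff simp_thms mult_zero_right)
  qed
  then show ?thesis by (simp add: algebra_simps)
qed

lemma T_braid:
  assumes "1 \<le> i" "i + 1 < n"
  shows "T n \<tau> i (T n \<tau> (i + 1) (T n \<tau> i p)) = T n \<tau> (i + 1) (T n \<tau> i (T n \<tau> (i + 1) p))"
proof (rule linear_op_eqI[where p = p])
  show "linear_op (\<lambda>p. T n \<tau> i (T n \<tau> (i + 1) (T n \<tau> i p)))"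
    "linear_op (\<lambda>p. T n \<tau> (i + 1) (T n \<tau> i (T n \<tau> (i + 1) p)))"
    by (intro linear_op_intros)+
  show "T n \<tau> i (T n \<tau> (i + 1) (T n \<tau> i 1)) = T n \<tau> (i + 1) (T n \<tau> i (T n \<tau> (i + 1) 1))"
    using assms by (simp add: T_1 chi_def C_simps(2))
  fix k p assume IH: "T n \<tau> i (T n \<tau> (i + 1) (T n \<tau> i p)) = T n \<tau> (i + 1) (T n \<tau> i (T n \<tau> (i + 1) p))"
  have *: "T n \<tau> i (X (i + 2) * q) = X (i + 2) * T n \<tau> i q" "T n \<tau> (i + 1) (X i * q) = X i * T n \<tau> (i + 1) q"
     "T n \<tau> (i + 1) (X (i + 2) * p) = X (i + 1) * T n \<tau> (i + 1) p + C (par_t \<tau>) * p" for q p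
    using T_X_middle(2)[of "i + 1" n \<tau> p] assms by (simp_all add: T_X_other refl_def)
  consider "k = i" | "k = i + 1" | "k = i + 2" | "k \<noteq> i" "k \<noteq> i + 1" "k \<noteq> i + 2" by blast
  then show "T n \<tau> i (T n \<tau> (i + 1) (T n \<tau> i (X k * p))) = T n \<tau> (i + 1) (T n \<tau> i (T n \<tau> (i + 1) (X k * p)))"
    by cases (use assms IH in \<open>simp_all add: T_X_middle T_square_middle * T_X_other refl_def T_linear op_expand
        T_X_middle[simplified] *[simplified]\<close>)
qed

lemma T_commute:
  assumes "n \<ge> 2" "i \<le> n" "j \<le> n" "i + 2 \<le> j"
  shows "T n \<tau> i (T n \<tau> j p) = T n \<tau> j (T n \<tau> i p)"
proof (rule linear_op_eqI[where p = p])
  show "linear_op (\<lambda>p. T n \<tau> i (T n \<tau> j p))"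
    "linear_op (\<lambda>p. T n \<tau> j (T n \<tau> i p))"
    by (intro linear_op_intros)+
  show "T n \<tau> i (T n \<tau> j 1) = T n \<tau> j (T n \<tau> i 1)"
    by (simp add: T_1 T_C mult.commute)
  fix k p assume IH: "T n \<tau> i (T n \<tau> j p) = T n \<tau> j (T n \<tau> i p)"
  have i: "T n \<tau> i (X j * q) = X j * T n \<tau> i q"
     "T n \<tau> i (X (j + 1) * q) = X (j + 1) * T n \<tau> i q" for q
    using assms by (auto intro!: T_X_other simp: refl_def)
  have j: "i \<noteq> 0 \<Longrightarrow> T n \<tau> j (X i * q) = X i * T n \<tau> j q"
     "T n \<tau> j (X (i + 1) * q) = X (i + 1) * T n \<tau> j q" for q
    using assms by (auto intro!: T_X_other simp: refl_def)
  have "refl n i X k = X k \<and> refl n j X k = X k \<or> i = 0 \<and> k = i + 1 \<or> i \<noteq> 0 \<and> (k = i \<or> k = i + 1)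
    \<or> j = n \<and> k = j \<or> j < n \<and> (k = j \<or> k = j + 1)"
    using assms by (auto simp: refl_def)
  then consider (other) "refl n i X k = X k" "refl n j X k = X k" | (first) "i = 0" "k = i + 1"
    | (left) "i \<noteq> 0" "k = i \<or> k = i + 1"
    | (last) "j = n" "k = j" | (right) "j < n" "k = j \<or> k = j + 1" by blast
  then show "T n \<tau> i (T n \<tau> j (X k * p)) = T n \<tau> j (T n \<tau> i (X k * p))"
  proof cases
    case other
    then show ?thesis using IH by (simp add: T_X_other)
  next
    case first
    then have "T n \<tau> i (X (i + 1) * q) = T n \<tau> i q - X (i + 1) * T n \<tau> i q +
       (C ((par_t0 \<tau>)\<^sup>2 - (par_u0 \<tau>)\<^sup>2 + 1 / 4) - X (i + 1) + (X (i + 1))\<^sup>2) * q" for q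
      using T_X_first[of n \<tau> q] by simp
    then show ?thesis using IH j(2) by (simp add: first(2) T_linear op_expand)
  next
    case left
    then show ?thesis using IH j assms T_X_middle[of i n \<tau>] by (auto simp: T_linear op_expand)
  next
    case last
    then have "T n \<tau> j (X j * q) = - (X j * T n \<tau> j q) - (C ((par_tn \<tau>)\<^sup>2 - (par_un \<tau>)\<^sup>2) + (X j)\<^sup>2) * q" for q
      using T_X_last[of n \<tau> q] assms by simp
    then show ?thesis using IH i(1) by (simp add: last(2) T_linear op_expand)
  next
    case right
    then show ?thesis using IH i assms T_X_middle[of j n \<tau>] by (auto simp: T_linear op_expand)
  qed
qed

lemma linear_op_T_word: "linear_op (T_word n \<tau> ws)"
  by (induction ws) (simp_all add: T_word_def comp_def id_def linear_op_id linear_op_comp[OF linear_op_T])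

lemma linear_op_sum: "(\<And>j. j \<in> J \<Longrightarrow> linear_op (F j)) \<Longrightarrow> linear_op (\<lambda>p. \<Sum>j \<in> J. F j p)"
  by (auto simp: linear_op_def sum.distrib sum_distrib_left)

lemma commutator_anticommute:
  assumes P: "linear_op P" "\<And>p. P (P p) = C a * p" and Q: "linear_op Q" "\<And>p. Q (Q p) = C b * p"
  shows "P (P (Q p) - Q (P p)) = - (P (Q (P p)) - Q (P (P p)))"
    "Q (P (Q p) - Q (P p)) = - (P (Q (Q p)) - Q (P (Q p)))"
  by (simp_all add: linear_opD[OF P(1)] linear_opD[OF Q(1)] P(2) Q(2))

lemma poly_Y_superset:
  assumes "finite K" "Poly_Mapping.keys f \<subseteq> K"
  shows "poly_Y n \<tau> f p = (\<Sum>m \<in> K. C (Poly_Mapping.lookup f m) *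
     foldr (\<lambda>i. Y n \<tau> i ^^ Poly_Mapping.lookup m i) [1..<n + 1] p)"
  unfolding poly_Y_def using assms
  by (intro sum.mono_neutral_left) (auto simp: in_keys_iff C_simps)

lemma poly_Y_add: "poly_Y n \<tau> (f + g) p = poly_Y n \<tau> f p + poly_Y n \<tau> g p"
  by (subst (1 2 3) poly_Y_superset[of "Poly_Mapping.keys f \<union> Poly_Mapping.keys g"])
    (use Poly_Mapping.keys_add[of f g] in \<open>auto simp: lookup_add distrib_right sum.distrib C_simps\<close>)

lemma poly_Y_single:
  "poly_Y n \<tau> (Poly_Mapping.single m c) p = C c * foldr (\<lambda>i. Y n \<tau> i ^^ Poly_Mapping.lookup m i) [1..<n + 1] p"
  by (simp add: poly_Y_def C_simps)

lemma poly_Y_C: "poly_Y n \<tau> (C c) p = C c * p"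
proof -
  have "foldr (\<lambda>i. Y n \<tau> i ^^ 0) xs p = p" for xs :: "nat list" by (induction xs) auto
  then show ?thesis unfolding C_def poly_Y_single by (simp add: C_def)
qed

lemma poly_Y_C_X:
  assumes "k \<in> {1..n}"
  shows "poly_Y n \<tau> (C c * X k) p = C c * Y n \<tau> k p"
proof -
  have "foldr (\<lambda>i. Y n \<tau> i ^^ (if k = i then Suc 0 else 0)) xs p = (if k \<in> set xs then Y n \<tau> k p else p)"
    if "distinct xs" for xs
    using that by (induction xs) auto
  from this[of "[1..<n + 1]"] assms show ?thesis
    by (simp add: C_def X_def mult_single poly_Y_single lookup_single when_def del: upt_Suc)
qed

section \<open>Commutation of the operators \<open>Y\<^sub>i\<close>\<close>

locale wilson =
  fixes n :: nat and \<tau> :: params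
  assumes n2: "n \<ge> 2"
begin

abbreviation "TT \<equiv> T n \<tau>"
abbreviation "YY \<equiv> Y n \<tau>"
abbreviation "t \<equiv> par_t \<tau>"

definition A :: "nat \<Rightarrow> cpoly \<Rightarrow> cpoly" where
  "A i = T_word n \<tau> ([i..<n] @ [n] @ rev [i..<n])"

definition B :: "nat \<Rightarrow> cpoly \<Rightarrow> cpoly" where
  "B i = T_word n \<tau> (rev [1..<i] @ [0] @ [1..<i])"

lemma A_last: "A n p = TT n p"
  by (simp add: A_def T_word_def)

lemma A_rec: "i < n \<Longrightarrow> A i p = TT i (A (i + 1) (TT i p))"
  by (simp add: A_def T_word_def upt_conv_Cons)

lemma B_first: "B 1 p = TT 0 p" "B (Suc 0) p = TT 0 p"
  by (simp_all add: B_def T_word_def)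

lemma B_rec: "1 \<le> i \<Longrightarrow> B (i + 1) p = TT i (B i (TT i p))"
  by (simp add: B_def T_word_def)

lemma T_pair_adjacent: "T_pair n \<tau> i (i + 1) p = TT i p"
  by (simp add: T_pair_def T_word_def)

lemma T_pair_rec: "i + 1 < j \<Longrightarrow> T_pair n \<tau> i j p = TT i (T_pair n \<tau> (i + 1) j (TT i p))"
  by (simp add: T_pair_def T_word_def upt_conv_Cons)

lemma Y_eq: "YY i p = A i p + B i p + C t * (\<Sum>j = i + 1..n. T_pair n \<tau> i j p)"
  by (simp add: Y_def A_def B_def)

lemma linear_op_B: "linear_op (B i)" and linear_op_A: "linear_op (A i)"
  by (simp_all add: A_def B_def linear_op_T_word)

lemma linear_op_Y: "linear_op (YY i)"
  unfolding Y_eq T_pair_def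
  by (intro linear_op_add linear_op_A linear_op_B linear_op_mult linear_op_sum linear_op_T_word)

lemmas Y_linear = linear_opD[OF linear_op_Y]
lemmas B_linear = linear_opD[OF linear_op_B]

lemma T_sum: "TT i (\<Sum>j \<in> J. f j) = (\<Sum>j \<in> J. TT i (f j))"
  by (induction J rule: infinite_finite_induct) (simp_all add: T_linear)

lemma Y_last: "YY n p = TT n p + B n p"
  by (simp add: Y_eq A_last)

lemma Y_rec:
  assumes "1 \<le> i" "i < n"
  shows "YY i p = TT i (YY (i + 1) (TT i p)) + C t * TT i p"
proof -
  have "{i + 1..n} = insert (i + 1) {i + 2..n}" using assms by auto
  then have "(\<Sum>j = i + 1..n. T_pair n \<tau> i j p) = TT i p + (\<Sum>j = i + 2..n. TT i (T_pair n \<tau> (i + 1) j (TT i p)))"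
    using assms by (simp add: T_pair_adjacent[simplified] T_pair_rec[simplified])
  then show ?thesis
    using assms unfolding Y_eq
    by (simp add: A_rec B_rec[simplified] T_linear T_sum T_square_middle distrib_left)
qed

lemma T_commute':
  assumes "i \<le> n" "j \<le> n" "i + 2 \<le> j \<or> j + 2 \<le> i"
  shows "TT i (TT j p) = TT j (TT i p)"
  using assms T_commute[OF n2, of i j \<tau> p] T_commute[OF n2, of j i \<tau> p] by auto

lemma T_B_commute:
  assumes "1 \<le> j" "j \<le> n" "1 \<le> k" "k \<le> n" "k > j \<or> k + 1 < j"
  shows "TT k (B j p) = B j (TT k p)"
  using assms
proof (induction j arbitrary: k p rule: less_induct)
  case (less j)
  show ?case
  proof (cases "j = 1")
    case True
    then show ?thesis using less.prems by (simp add: B_first T_commute' n2)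
  next
    case False
    then obtain i where i: "j = i + 1" "1 \<le> i" using less.prems by (cases j) auto
    show ?thesis
    proof (cases "k + 1 = i")
      case True
      have b: "B j q = TT i (TT k (B k (TT k (TT i q))))" for q
        using i B_rec[of k "TT i q"] B_rec[of i q] True less.prems by simp
      have c: "TT i (B k q) = B k (TT i q)" for q
        using less.IH[of k i q] less.prems i True by simp
      have br: "TT k (TT i (TT k x)) = TT i (TT k (TT i x))" for x
        using T_braid[of k n \<tau> x] True i less.prems by simp
      show ?thesis unfolding b by (metis br c)
    next
      case False
      then have "k > i \<or> k + 1 < i" using less.prems(5) i by linarith
      then have "TT k (B i q) = B i (TT k q)" for q
        using less.IH[of i k q] less.prems i by simp
      moreover have "TT k (TT i q) = TT i (TT k q)" for q
        using False less.prems i by (intro T_commute') auto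
      ultimately show ?thesis using i B_rec[of i] by simp
    qed
  qed
qed

lemma B_reflection_equation:
  assumes "1 \<le> j" "j < n"
  shows "B j (TT j (B j (TT j p))) + C t * B j (TT j p) = TT j (B j (TT j (B j p))) + C t * TT j (B j p)"
  using assms
proof (induction j arbitrary: p rule: nat_induct_at_least)
  case base
  then show ?case using reflection_equation_first[OF n2, of \<tau> p] by (simp add: B_first)
next
  case (Suc j)
  define s where "s = TT j"
  define r where "r = TT (j + 1)"
  define b where "b = B j"
  have s: "s (s x) = x" and r: "r (r x) = x" and braid: "s (r (s x)) = r (s (r x))"
    and comm: "r (b x) = b (r x)" for x
    using Suc T_braid[of j n \<tau>] by (simp_all add: s_def r_def b_def T_square_middle T_B_commute)
  have B: "B (j + 1) x = s (b (s x))" for x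
    using Suc by (simp add: B_rec[simplified] s_def b_def)
  have lin: "s (x + y) = s x + s y" "s (C c * x) = C c * s x" "r (x + y) = r x + r y" "r (C c * x) = C c * r x" for x y c
    by (simp_all add: s_def r_def T_linear)
  have "s (r (b (s (b (s (r (s p))))) + C t * b (s (r (s p))))) =
        s (r (s (b (s (b (r (s p))))) + C t * s (b (r (s p)))))"
    using Suc.IH[of "r (s p)"] Suc.prems unfolding s_def b_def by simp
  moreover have "s (r (b (s (b (s (r (s p))))))) = s (b (s (r (s (b (s (r p)))))))"
    by (metis braid comm)
  moreover have "s (r (b (s (r (s p))))) = s (b (s (r p)))"
    by (metis braid comm s)
  moreover have "s (r (s (b (s (b (r (s p))))))) = r (s (b (s (r (s (b (s p)))))))"
    by (metis braid comm)
  moreover have "s (r (s (b (r (s p))))) = r (s (b (s p)))"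
    by (metis braid comm r)
  ultimately show ?case
    unfolding Suc_eq_plus1 B r_def[symmetric] by (simp add: lin)
qed

lemma T_Y_commute:
  assumes "1 \<le> j" "j \<le> n" "1 \<le> k" "k < n" "k \<noteq> j" "k + 1 \<noteq> j"
  shows "TT k (YY j p) = YY j (TT k p)"
  using assms
proof (induction "n - j" arbitrary: j k p rule: less_induct)
  case less
  show ?case
  proof (cases "j = n")
    case True
    then show ?thesis using less.prems by (simp add: Y_last T_linear T_commute' T_B_commute)
  next
    case False
    then have j: "1 \<le> j" "j < n" using less.prems by auto
    show ?thesis
    proof (cases "k = j + 1")
      case True
      have br: "TT k (TT j (TT k x)) = TT j (TT k (TT j x))" for x
        using T_braid[of j n \<tau> x] True less.prems by simp
      have Y: "YY j x = TT j (TT k (YY (k + 1) (TT k (TT j x)))) + C t * TT j (TT k (TT j x)) + C t * TT j x" for x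
        using True less.prems Y_rec[of j x] Y_rec[of k "TT j x"] by (simp add: T_linear)
      have c: "TT j (YY (k + 1) x) = YY (k + 1) (TT j x)" for x
        using less.hyps[of "k + 1" j x] less.prems True by simp
      have sq: "TT k (TT k x) = x" "TT j (TT j x) = x" for x
        using j less.prems by (simp_all add: T_square_middle)
      have "TT k (TT j (TT k (YY (k + 1) (TT k (TT j p))))) = TT j (TT k (YY (k + 1) (TT k (TT j (TT k p)))))"
        by (metis br c)
      moreover have "TT k (TT j (TT k (TT j p))) = TT j (TT k p)" "TT j (TT k (TT j (TT k p))) = TT k (TT j p)"
        by (metis br sq)+
      ultimately show ?thesis unfolding Y by (simp add: T_linear)
    next
      case False
      then have "TT k (TT j x) = TT j (TT k x)" for x
        using less.prems by (intro T_commute') auto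
      moreover have "TT k (YY (j + 1) x) = YY (j + 1) (TT k x)" for x
        using less.hyps[of "j + 1" k x] less.prems False j by simp
      ultimately show ?thesis using j by (simp add: Y_rec[of j] T_linear)
    qed
  qed
qed

lemma T_last_Y_commute:
  assumes "1 \<le> j" "j < n"
  shows "TT n (YY j p) = YY j (TT n p)"
proof -
  have "j \<le> n - 1" using assms by simp
  then show ?thesis using assms
  proof (induction j arbitrary: p rule: inc_induct)
    case base
    have n: "Suc (n - Suc 0) = n" using n2 by simp
    have Y: "YY (n - 1) x = TT (n - 1) (TT n (TT (n - 1) x)) + C t * TT (n - 1) x + B (n - 1) x" for x
      using Y_rec[of "n - 1" x] Y_last[of "TT (n - 1) x"] B_rec[of "n - 1" "TT (n - 1) x"] n2 n
      by (simp add: T_linear T_square_middle)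
    have "TT n (B (n - 1) p) = B (n - 1) (TT n p)" using T_B_commute n2 by simp
    with reflection_equation_last[OF n2, of \<tau> p] show ?case
      unfolding Y by (simp add: T_linear algebra_simps)
  next
    case (step j)
    have "TT n (TT j x) = TT j (TT n x)" for x
      using step by (intro T_commute') auto
    with step show ?case using Y_rec[of j] by (simp add: T_linear)
  qed
qed

lemma Y_penultimate: "YY (n - 1) p = TT (n - 1) (TT n (TT (n - 1) p)) + C t * TT (n - 1) p + B (n - 1) p"
proof -
  have n: "Suc (n - Suc 0) = n" using n2 by simp
  show ?thesis
    using Y_rec[of "n - 1" p] Y_last[of "TT (n - 1) p"] B_rec[of "n - 1" "TT (n - 1) p"] n2 n
    by (simp add: T_linear T_square_middle)
qed

lemma Y_commute_last: "YY (n - 1) (YY n p) = YY n (YY (n - 1) p)"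
proof -
  define s b where "s = TT (n - 1)" and "b = B (n - 1)"
  have n: "Suc (n - Suc 0) = n" using n2 by simp
  have Yn: "YY n x = TT n x + s (b (s x))" for x
    using n2 n B_rec[of "n - 1" x] by (simp add: Y_last s_def b_def)
  have Ym: "YY (n - 1) x = s (TT n (s x)) + C t * s x + b x" for x
    by (simp only: Y_penultimate s_def b_def)
  have c: "TT n (b x) = b (TT n x)" for x
    unfolding b_def using n2 by (intro T_B_commute) auto
  have sq: "s (s x) = x" for x using n2 by (simp add: s_def T_square_middle)
  have "b (s (b (s p))) + C t * b (s p) = s (b (s (b p))) + C t * s (b p)"
    unfolding s_def b_def using n2 by (intro B_reflection_equation) auto
  moreover have "TT n (s (TT n (s p))) + C t * TT n (s p) = s (TT n (s (TT n p))) + C t * s (TT n p)"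
    unfolding s_def by (rule reflection_equation_last[OF n2])
  ultimately show ?thesis
    unfolding Yn Ym using T_linear[of n \<tau> "n - 1", folded s_def] B_linear[of "n - 1", folded b_def]
    by (simp add: T_linear c sq distrib_left) (simp add: add_ac)
qed

lemma Y_commute_aux:
  assumes "1 \<le> i" "i < j" "j \<le> n"
  shows "YY i (YY j p) = YY j (YY i p)"
proof -
  have last: "YY i (YY n p) = YY n (YY i p)" if "1 \<le> i" "i < n" for i p
  proof -
    have "i \<le> n - 1" using that by simp
    then show ?thesis using that
    proof (induction i arbitrary: p rule: inc_induct)
      case base
      show ?case by (rule Y_commute_last)
    next
      case (step i)
      have "TT i (YY n x) = YY n (TT i x)" for x
        using step by (intro T_Y_commute) auto
      then show ?case using step Y_rec[of i] by (simp add: T_linear Y_linear)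
    qed
  qed
  show ?thesis
    using assms(3,1,2)
  proof (induction j arbitrary: p rule: inc_induct)
    case base
    then show ?case by (intro last) auto
  next
    case (step j)
    have "YY i (TT j x) = TT j (YY i x)" for x
      using step by (intro T_Y_commute [symmetric]) auto
    then show ?case using step Y_rec[of j] by (simp add: T_linear Y_linear)
  qed
qed

lemma Y_commute:
  assumes "i \<in> {1..n}" "j \<in> {1..n}"
  shows "YY i (YY j p) = YY j (YY i p)"
  using assms Y_commute_aux[of i j p] Y_commute_aux[of j i p] by (cases i j rule: linorder_cases) auto

definition V :: "cpoly \<Rightarrow> cpoly" where
  "V p = TT 0 p - X 1 * p"

lemma U_eq: "U n \<tau> p = V p - YY 1 p"
  and U_square: "U n \<tau> (U n \<tau> p) = C ((par_un \<tau>)\<^sup>2) * p"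
proof -
  define U' where "U' i p = T_word n \<tau> [i..<n] ((\<lambda>q. - (X n * q) - TT n q) (T_word n \<tau> (rev [i..<n]) p))" for i p
  have last: "U' n p = - (X n * p) - TT n p" for p
    by (simp add: U'_def T_word_def)
  have rec: "U' i p = TT i (U' (i + 1) (TT i p))" if "i < n" for i p
    using that by (simp add: U'_def T_word_def upt_conv_Cons)
  have U: "U n \<tau> p = U' 1 p" for p by (simp add: U_def U'_def)
  have 1: "1 \<le> n" using n2 by simp
  have "U' i p = B i p - X i * p - YY i p" if "1 \<le> i" "i \<le> n" for i
    using that(2,1)
  proof (induction i arbitrary: p rule: inc_induct)
    case base
    then show ?case by (simp add: last Y_last)
  next
    case (step i)
    then show ?case
      using Y_rec[of i p] B_rec[of i "TT i p"]
      by (simp add: rec T_linear B_rec[simplified] T_X_middle[simplified] T_square_middle)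
  qed
  from this[of 1] 1 show "U n \<tau> p = V p - YY 1 p" by (simp add: U V_def B_first)
  have "U' i (U' i p) = C ((par_un \<tau>)\<^sup>2) * p" if "1 \<le> i" "i \<le> n" for i
    using that(2,1)
  proof (induction i arbitrary: p rule: inc_induct)
    case base
    then show ?case
      using n2 by (simp add: last T_linear T_X_last T_square[of n n] chi_def C_simps op_expand)
  next
    case (step i)
    then show ?case
      by (simp add: rec T_linear T_square_middle)
  qed
  then show "U n \<tau> (U n \<tau> p) = C ((par_un \<tau>)\<^sup>2) * p" using 1 by (simp add: U)
qed

lemma V_square: "V (V p) = C ((par_u0 \<tau>)\<^sup>2 - 1 / 4) * p - V p"
  using n2 by (simp add: V_def T_linear T_X_first[simplified] T_square[of n 0] chi_def C_simps op_expand)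

lemma V_T_commute:
  assumes "2 \<le> k" "k \<le> n"
  shows "V (TT k p) = TT k (V p)"
proof -
  have "TT k (X 1 * p) = X 1 * TT k p"
    using assms by (intro T_X_other) (simp add: refl_def)
  then show ?thesis using assms by (simp add: V_def T_linear T_commute')
qed

lemma linear_op_V: "linear_op V"
  unfolding V_def by (intro linear_op_intros)

lemmas V_linear = linear_opD[OF linear_op_V]

lemma V_B_commute:
  assumes "2 \<le> j" "j \<le> n"
  shows "V (B j p) = B j (V p)"
  using assms
proof (induction j arbitrary: p rule: nat_induct_at_least)
  case base
  have X: "TT 1 (X 1 * q) = X 2 * TT 1 q - C t * q" "TT 1 (X 2 * q) = X 1 * TT 1 q + C t * q"
    "TT 0 (X 2 * q) = X 2 * TT 0 q" for q
    using T_X_middle[of 1 n \<tau> q] n2 T_X_other[of n 0 2 \<tau> q] by (simp_all add: numeral_2_eq_2 refl_def)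
  have B: "B 2 p = TT 1 (TT 0 (TT 1 p))" for p
    using B_rec[of 1 p] by (simp add: B_first numeral_2_eq_2)
  show ?case
    using reflection_equation_first[OF n2, of \<tau> p]
    unfolding B V_def by (simp only: T_linear X) (simp add: algebra_simps)
next
  case (Suc j)
  then show ?case using B_rec[of j] by (simp add: V_T_commute)
qed

lemma V_Y_commute:
  assumes "2 \<le> j" "j \<le> n"
  shows "V (YY j p) = YY j (V p)"
  using assms(2,1)
proof (induction j arbitrary: p rule: inc_induct)
  case base
  then show ?case by (simp add: Y_last V_linear V_T_commute V_B_commute)
next
  case (step j)
  then show ?case using Y_rec[of j] by (simp add: V_linear V_T_commute)
qed

lemma linear_op_U: "linear_op (U n \<tau>)"
  unfolding U_eq by (intro linear_op_diff linear_op_V linear_op_Y)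

lemma U_Y_commute:
  assumes "2 \<le> j" "j \<le> n"
  shows "U n \<tau> (YY j p) = YY j (U n \<tau> p)"
  using assms Y_commute[of 1 j p] by (simp add: U_eq Y_linear V_Y_commute)

section \<open>Intertwiners and joint eigenvectors\<close>

lemma S_eqs:
  "S n \<tau> 0 p = 2 * (YY 1 (U n \<tau> p) - U n \<tau> (YY 1 p))"
  "1 \<le> i \<Longrightarrow> i < n \<Longrightarrow> S n \<tau> i p = TT i (YY i p - YY (i + 1) p) - (YY i (TT i p) - YY (i + 1) (TT i p))"
  "S n \<tau> n p = 2 * (TT n (YY n p) - YY n (TT n p))"
proof -
  have "a_poly n 0 = C 1 + C (-2) * X 1" by (simp add: a_poly_def C_simps)
  then have 0: "poly_Y n \<tau> (a_poly n 0) p = p - 2 * YY 1 p" for p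
    using n2 by (simp only: poly_Y_add poly_Y_C) (subst poly_Y_C_X, auto simp: C_simps)
  show "S n \<tau> 0 p = 2 * (YY 1 (U n \<tau> p) - U n \<tau> (YY 1 p))"
    by (simp add: S_def commutator_def 0 linear_opD[OF linear_op_U])
  have an: "a_poly n n = C 2 * X n" using n2 by (simp add: a_poly_def C_simps)
  have n: "poly_Y n \<tau> (a_poly n n) p = 2 * YY n p" for p
    unfolding an by (subst poly_Y_C_X) (use n2 in \<open>auto simp: C_simps\<close>)
  show "S n \<tau> n p = 2 * (TT n (YY n p) - YY n (TT n p))"
    using n2 by (simp add: S_def commutator_def n T_linear)
  assume i: "1 \<le> i" "i < n"
  then have ai: "a_poly n i = C 1 * X i + C (-1) * X (i + 1)" by (simp add: a_poly_def C_simps)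
  have "i \<in> {1..n}" "i + 1 \<in> {1..n}" using i by auto
  then have "poly_Y n \<tau> (a_poly n i) p = YY i p - YY (i + 1) p" for p
    by (simp only: ai poly_Y_add poly_Y_C_X) (simp add: C_simps)
  then show "S n \<tau> i p = TT i (YY i p - YY (i + 1) p) - (YY i (TT i p) - YY (i + 1) (TT i p))"
    using i by (simp add: S_def commutator_def)
qed

definition joint_eigen :: "(nat \<Rightarrow> complex) \<Rightarrow> cpoly \<Rightarrow> bool" where
  "joint_eigen g p \<longleftrightarrow> (\<forall>j \<in> {1..n}. YY j p = C (g j) * p)"

lemma joint_eigen_1: "joint_eigen (gamma0 n \<tau>) 1"
proof -
  have A: "A i 1 = C (par_tn \<tau>)" if "1 \<le> i" "i \<le> n" for i
    using that(2,1)
    by (induction i rule: inc_induct) (use n2 in \<open>auto simp: A_last A_rec[simplified] T_1 chi_def C_simps T_C\<close>)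
  have B: "B i 1 = C (par_t0 \<tau>)" if "1 \<le> i" "i \<le> n" for i
    using that
    by (induction i rule: nat_induct_at_least) (auto simp: B_first B_rec[simplified] T_1 chi_def C_simps T_C)
  have P: "T_pair n \<tau> i j 1 = 1" if "1 \<le> i" "i < j" "j \<le> n" for i j
  proof -
    have "i \<le> j - 1" using that by simp
    then show ?thesis using that
    proof (induction i rule: inc_induct)
      case base
      then have "\<not> j \<le> Suc 0" "j - Suc 0 \<noteq> n" by auto
      with base show ?case using T_pair_adjacent[of "j - 1" 1] by (simp add: T_1 chi_def C_simps)
    next
      case (step i)
      then show ?case by (simp add: T_pair_rec[simplified] T_1 chi_def C_simps)
    qed
  qed
  show ?thesis
    unfolding joint_eigen_def by (auto simp: Y_eq A B P gamma0_def C_simps)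
qed

lemma joint_eigen_S:
  assumes k: "k \<le> n" and p: "joint_eigen g p"
  shows "joint_eigen (dot_refl n k g) (S n \<tau> k p)"
  unfolding joint_eigen_def
proof
  fix j assume j: "j \<in> {1..n}"
  have eig: "YY i p = C (g i) * p" if "i \<in> {1..n}" for i
    using p that by (auto simp: joint_eigen_def)
  consider "k = 0" | "k = n" "k \<noteq> 0" | "1 \<le> k" "k < n" using k by linarith
  then show "YY j (S n \<tau> k p) = C (dot_refl n k g j) * S n \<tau> k p"
  proof cases
    case 1
    define D where "D p = YY 1 (U n \<tau> p) - U n \<tau> (YY 1 p)" for p
    have S: "S n \<tau> k p = 2 * D p" using 1 by (simp add: S_eqs D_def)
    have D: "YY j (D p) = C (dot_refl n k g j) * D p"
    proof (cases "j = 1")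
      case False
      have "YY j (YY 1 x) = YY 1 (YY j x)" "YY j (U n \<tau> x) = U n \<tau> (YY j x)" for x
        using False j n2 by (intro Y_commute U_Y_commute [symmetric]; auto)+
      then have "YY j (D p) = YY 1 (U n \<tau> (YY j p)) - U n \<tau> (YY 1 (YY j p))"
        by (simp only: D_def Y_linear)
      then show ?thesis
        using 1 False j eig[of j] by (simp add: D_def dot_refl_def Y_linear linear_opD[OF linear_op_U] right_diff_distrib)
    next
      case True
      define W where "W p = V p + C (1 / 2) * p" for p
      have lin: "linear_op W" unfolding W_def by (intro linear_op_intros linear_op_V)
      have sq: "W (W p) = C ((par_u0 \<tau>)\<^sup>2) * p" for p
      proof -
        have "C ((par_u0 \<tau>)\<^sup>2) * p = C ((par_u0 \<tau>)\<^sup>2 - 1 / 4) * p + C (1 / 2) * (C (1 / 2) * p)"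
          by (simp add: C_simps(4) [symmetric] C_simps(3) [symmetric] mult.assoc [symmetric]
              distrib_right [symmetric])
        then show ?thesis using C_half[of "V p"]
          by (simp add: W_def V_linear V_square distrib_left)
      qed
      have Y1: "YY 1 p = W p - U n \<tau> p - C (1 / 2) * p" for p
        by (simp add: W_def U_eq)
      have D: "D p = W (U n \<tau> p) - U n \<tau> (W p)" for p
      proof -
        have "U n \<tau> (YY 1 p) = U n \<tau> (W p) - U n \<tau> (U n \<tau> p) - C (1 / 2) * U n \<tau> p"
          by (simp only: Y1 linear_opD[OF linear_op_U])
        then show ?thesis unfolding D_def Y1[of "U n \<tau> p"] by simp
      qed
      note anti = commutator_anticommute[OF lin sq linear_op_U U_square, folded D]
      have linD: "linear_op D"
        unfolding D_def
        by (intro linear_op_diff linear_op_comp[OF linear_op_Y linear_op_U]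
            linear_op_comp[OF linear_op_U linear_op_Y])
      have "D (YY 1 p) = D (W p) - D (U n \<tau> p) - C (1 / 2) * D p"
        unfolding Y1 by (simp only: linear_opD[OF linD])
      moreover have "YY 1 (D p) = - D (W p) + D (U n \<tau> p) - C (1 / 2) * D p"
        unfolding Y1[of "D p"] anti by simp
      ultimately have "YY 1 (D p) = - D (YY 1 p) - (C (1 / 2) * D p + C (1 / 2) * D p)"
        by (simp only:) (simp add: algebra_simps)
      then have "YY 1 (D p) = - D (YY 1 p) - D p" unfolding C_half .
      moreover have "D (YY 1 p) = C (g 1) * D p"
        using eig[of 1] n2 by (simp add: linear_opD[OF linD])
      ultimately show ?thesis using True 1 by (simp add: dot_refl_def C_simps left_diff_distrib)
    qed
    show ?thesis unfolding S by (simp add: Y_linear D mult.left_commute)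
  next
    case 2
    define D where "D p = TT n (YY n p) - YY n (TT n p)" for p
    have S: "S n \<tau> k p = 2 * D p" using 2 by (simp add: S_eqs D_def)
    have D: "YY j (D p) = C (dot_refl n k g j) * D p"
    proof (cases "j = n")
      case False
      have "YY j (YY n x) = YY n (YY j x)" "YY j (TT n x) = TT n (YY j x)" for x
        using False j n2 by (intro Y_commute T_last_Y_commute [symmetric]; auto)+
      then have "YY j (D p) = TT n (YY n (YY j p)) - YY n (TT n (YY j p))"
        by (simp only: D_def Y_linear)
      then show ?thesis
        using 2 False j eig[of j] by (simp add: D_def dot_refl_def refl_def Y_linear T_linear right_diff_distrib)
    next
      case True
      have sq: "B j (B j p) = C ((par_t0 \<tau>)\<^sup>2) * p" if "1 \<le> j" "j \<le> n" for j p
        using that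
      proof (induction j arbitrary: p rule: nat_induct_at_least)
        case base
        then show ?case using n2 by (simp add: B_first T_square[of n 0] chi_def)
      next
        case (Suc j)
        then show ?case by (simp add: B_rec[simplified] T_square_middle T_linear)
      qed
      have D: "D p = TT n (B n p) - B n (TT n p)" for p
        by (simp add: D_def Y_last T_linear)
      have "TT n (TT n p) = C ((chi n \<tau> n)\<^sup>2) * p" "B n (B n p) = C ((par_t0 \<tau>)\<^sup>2) * p" for p
        using n2 sq by (simp_all add: T_square[of n n])
      note anti = commutator_anticommute[OF linear_op_T this(1) linear_op_B this(2), folded D]
      have "YY n (D p) = - D (TT n p) - D (B n p)"
        using anti n2 by (simp add: Y_last)
      moreover have "D (TT n p) + D (B n p) = C (g n) * D p"
      proof -
        have "D (TT n p) + D (B n p) = D (YY n p)"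
          by (simp add: D Y_last T_linear B_linear)
        also have "\<dots> = C (g n) * D p" using eig[of n] n2 by (simp add: D T_linear B_linear right_diff_distrib)
        finally show ?thesis .
      qed
      ultimately show ?thesis using True 2
        by (simp add: dot_refl_def refl_def C_simps) (simp add: algebra_simps)
    qed
    show ?thesis unfolding S by (simp add: Y_linear D mult.left_commute)
  next
    case 3
    have e: "YY k p = C (g k) * p" "YY (k + 1) p = C (g (k + 1)) * p" using eig 3 by auto
    have Yk: "YY k (TT k p) = C (g (k + 1)) * TT k p + C t * p"
      using 3 Y_rec[of k "TT k p"] e by (simp add: T_square_middle T_linear)
    have "TT k (YY k p) = YY (k + 1) (TT k p) + C t * p"
      using 3 Y_rec[of k p] by (simp add: T_square_middle T_linear)
    then have Yk1: "YY (k + 1) (TT k p) = C (g k) * TT k p - C t * p"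
      using e by (simp add: T_linear)
    have S: "S n \<tau> k p = C (2 * (g k - g (k + 1))) * TT k p - C (2 * t) * p"
      using 3 by (simp only: S_eqs e Yk Yk1 T_linear) (simp add: C_simps algebra_simps)
    consider "j = k" | "j = k + 1" | "j \<noteq> k" "j \<noteq> k + 1" by blast
    then show ?thesis
    proof cases
      case 1
      then show ?thesis
        using 3 unfolding S Y_linear 1 Yk e(1)
        by (simp add: dot_refl_def refl_def C_simps) (simp add: algebra_simps)
    next
      case 2
      then show ?thesis
        using 3 unfolding S Y_linear 2 Yk1 e(2)
        by (simp add: dot_refl_def refl_def C_simps) (simp add: algebra_simps)
    next
      case neq: 3
      have "YY j (TT k p) = C (g j) * TT k p"
        using T_Y_commute[of j k p] neq 3 j eig[of j] by (simp add: T_linear)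
      then show ?thesis
        using 3 neq unfolding S by (simp add: Y_linear(2,5) eig[OF j] dot_refl_def refl_def
            right_diff_distrib mult.left_commute)
    qed
  qed
qed

lemma joint_eigen_word:
  assumes "ws \<in> words n"
  shows "joint_eigen (foldr (dot_refl n) ws (gamma0 n \<tau>)) (foldr (S n \<tau>) ws 1)"
  using assms by (induction ws) (auto simp: words_def joint_eigen_1 joint_eigen_S)

lemma joint_eigen_poly_Y:
  assumes p: "joint_eigen g p" and f: "f \<in> polys n"
  shows "poly_Y n \<tau> f p = C (eval_at g f) * p"
proof -
  have pow: "(YY i ^^ e) (C c * p) = C (g i ^ e * c) * p" if "i \<in> {1..n}" for i e c
  proof (induction e)
    case (Suc e)
    have "(YY i ^^ Suc e) (C c * p) = C (g i ^ e * c) * YY i p"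
      using Suc by (simp add: Y_linear(2))
    also have "\<dots> = C (g i ^ Suc e * c) * p"
      using p that by (simp add: joint_eigen_def C_simps mult_ac)
    finally show ?case .
  qed simp
  have fold: "foldr (\<lambda>i. YY i ^^ Poly_Mapping.lookup m i) xs p = C (\<Prod>i \<leftarrow> xs. g i ^ Poly_Mapping.lookup m i) * p"
    if "set xs \<subseteq> {1..n}" for xs m
    using that by (induction xs) (auto simp: C_simps(2) pow)
  have "foldr (\<lambda>i. YY i ^^ Poly_Mapping.lookup m i) [1..<n + 1] p =
      C (\<Prod>i \<in> Poly_Mapping.keys m. g i ^ Poly_Mapping.lookup m i) * p" if "m \<in> Poly_Mapping.keys f" for m
  proof -
    have "(\<Prod>i \<leftarrow> [1..<n + 1]. g i ^ Poly_Mapping.lookup m i) = (\<Prod>i \<in> {1..n}. g i ^ Poly_Mapping.lookup m i)"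
      by (subst prod.distinct_set_conv_list [symmetric]) (auto intro: prod.cong)
    also have "\<dots> = (\<Prod>i \<in> Poly_Mapping.keys m. g i ^ Poly_Mapping.lookup m i)"
      using f that by (intro prod_superset [symmetric]) (auto simp: polys_def)
    finally show ?thesis using fold[of "[1..<n + 1]" m]
      by (simp add: atLeastLessThanSuc_atLeastAtMost del: upt_Suc)
  qed
  moreover have "C (sum h M) = (\<Sum>m \<in> M. C (h m))" for h :: "(nat \<Rightarrow>\<^sub>0 nat) \<Rightarrow> complex" and M
    by (induction M rule: infinite_finite_induct) (simp_all add: C_simps)
  ultimately show ?thesis
    by (simp add: poly_Y_def eval_at_def insertion_def C_simps sum_distrib_right mult.assoc del: upt_Suc)
qed

section \<open>The dot orbit of the origin\<close>

definition orbit0 :: "(nat \<Rightarrow> complex) set" where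
  "orbit0 = (\<lambda>ws. foldr (dot_refl n) ws (\<lambda>_. 0)) ` words n"

lemma orbit0_zero: "(\<lambda>_. 0) \<in> orbit0"
  unfolding orbit0_def by (rule image_eqI[of _ _ "[]"]) (auto simp: words_def)

lemma orbit0_dot_refl: "x \<in> orbit0 \<Longrightarrow> i \<le> n \<Longrightarrow> dot_refl n i x \<in> orbit0"
  unfolding orbit0_def by (auto simp: words_def intro!: image_eqI[of _ _ "i # _"])

lemma orbit0_swap:
  assumes "x \<in> orbit0" "1 \<le> i" "i < n"
  shows "x(i := x (i + 1), i + 1 := x i) \<in> orbit0"
  using orbit0_dot_refl[OF assms(1), of i] assms by (simp add: dot_refl_def refl_def)

lemma orbit0_negate:
  assumes "x \<in> orbit0" "1 \<le> i" "i \<le> n"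
  shows "x(i := - x i) \<in> orbit0"
proof -
  have "\<forall>x \<in> orbit0. x(i := - x i) \<in> orbit0"
    using assms(3,2)
  proof (induction i rule: inc_induct)
    case base
    then show ?case using orbit0_dot_refl[of _ n] n2 by (auto simp: dot_refl_def refl_def fun_upd_def)
  next
    case (step i)
    show ?case
    proof
      fix x assume "x \<in> orbit0"
      define y where "y = x(i := x (i + 1), i + 1 := x i)"
      define z where "z = y(i + 1 := - y (i + 1))"
      have "y \<in> orbit0" unfolding y_def using \<open>x \<in> orbit0\<close> step by (intro orbit0_swap) auto
      then have "z \<in> orbit0" using step by (simp add: z_def fun_upd_def)
      then have "z(i := z (i + 1), i + 1 := z i) \<in> orbit0" using step by (intro orbit0_swap) auto
      also have "z(i := z (i + 1), i + 1 := z i) = x(i := - x i)" by (auto simp: z_def y_def fun_eq_iff)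
      finally show "x(i := - x i) \<in> orbit0" .
    qed
  qed
  then show ?thesis using assms(1) by blast
qed

lemma orbit0_negate_shift:
  assumes "x \<in> orbit0" "1 \<le> i" "i \<le> n"
  shows "x(i := - x i - 1) \<in> orbit0"
proof -
  have "\<forall>x \<in> orbit0. x(i := - x i - 1) \<in> orbit0"
    using assms(2,3)
  proof (induction i rule: nat_induct_at_least)
    case base
    then show ?case using orbit0_dot_refl[of _ 0] n2 by (auto simp: dot_refl_def fun_upd_def)
  next
    case (Suc i)
    show ?case
    proof
      fix x assume "x \<in> orbit0"
      define y where "y = x(i := x (i + 1), i + 1 := x i)"
      define z where "z = y(i := - y i - 1)"
      have "y \<in> orbit0" unfolding y_def using \<open>x \<in> orbit0\<close> Suc by (intro orbit0_swap) auto
      then have "z \<in> orbit0" using Suc by (simp add: z_def fun_upd_def)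
      then have "z(i := z (i + 1), i + 1 := z i) \<in> orbit0" using Suc by (intro orbit0_swap) auto
      also have "z(i := z (i + 1), i + 1 := z i) = x(Suc i := - x (Suc i) - 1)"
        by (auto simp: z_def y_def fun_eq_iff)
      finally show "x(Suc i := - x (Suc i) - 1) \<in> orbit0" .
    qed
  qed
  then show ?thesis using assms(1) by blast
qed

lemma orbit0_translate:
  assumes "x \<in> orbit0" "1 \<le> i" "i \<le> n"
  shows "x(i := x i + of_int c) \<in> orbit0"
proof -
  have up: "x(i := x i + 1) \<in> orbit0" if "x \<in> orbit0" for x
    using orbit0_negate[OF orbit0_negate_shift[OF that assms(2,3)] assms(2,3)] by (simp add: add.commute)
  have down: "x(i := x i - 1) \<in> orbit0" if "x \<in> orbit0" for x
    using orbit0_negate_shift[OF orbit0_negate[OF that assms(2,3)] assms(2,3)] by simp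
  show ?thesis
  proof (induction c rule: int_induct[where k = 0])
    case base
    then show ?case using assms by simp
  next
    case (step1 c)
    from step1(2) have "x(i := x i + of_int c) \<in> orbit0" .
    from up[OF this] have "x(i := x i + of_int (c + 1)) \<in> orbit0" by (simp add: add.assoc)
    then show ?case .
  next
    case (step2 c)
    from step2(2) have "x(i := x i + of_int c) \<in> orbit0" .
    from down[OF this] have "x(i := x i + of_int (c - 1)) \<in> orbit0" by (simp add: algebra_simps)
    then show ?case .
  qed
qed

lemma orbit0_lattice:
  assumes "lam \<in> lattice n"
  shows "(\<lambda>i. of_int (lam i)) \<in> orbit0"
proof -
  have "k \<le> n \<Longrightarrow> (\<lambda>i. if i \<le> k then of_int (lam i) else 0) \<in> orbit0" for k
  proof (induction k)
    case 0
    have "lam 0 = 0" using assms by (simp add: lattice_def)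
    then have "(\<lambda>i. if i \<le> 0 then of_int (lam i) else 0) = (\<lambda>_. 0 :: complex)" by auto
    then show ?case using orbit0_zero by simp
  next
    case (Suc k)
    let ?x = "\<lambda>i. if i \<le> k then of_int (lam i) else 0 :: complex"
    have "?x(Suc k := ?x (Suc k) + of_int (lam (Suc k))) \<in> orbit0"
      using Suc by (intro orbit0_translate) auto
    also have "?x(Suc k := ?x (Suc k) + of_int (lam (Suc k))) = (\<lambda>i. if i \<le> Suc k then of_int (lam i) else 0)"
      by (auto simp: fun_eq_iff le_Suc_eq)
    finally show ?case .
  qed
  from this[of n] have "(\<lambda>i. if i \<le> n then of_int (lam i) else 0) \<in> orbit0" by simp
  also have "(\<lambda>i. if i \<le> n then of_int (lam i) else 0) = (\<lambda>i. of_int (lam i) :: complex)"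
    using assms by (auto simp: lattice_def fun_eq_iff)
  finally show ?thesis .
qed

lemma u_elt_weyl:
  assumes "lam \<in> lattice n"
  shows "u_elt n lam \<in> weyl n"
proof -
  obtain ws where ws: "ws \<in> words n" "foldr (dot_refl n) ws (\<lambda>_. 0) = (\<lambda>i. of_int (lam i))"
    using orbit0_lattice[OF assms] by (auto simp: orbit0_def)
  have "word_elt n ws \<in> weyl n \<and> dot n (word_elt n ws) (\<lambda>_. 0) = (\<lambda>i. of_int (lam i))"
    using ws by (simp add: weyl_def dot_word_elt)
  from arg_min_natI[of "\<lambda>w. w \<in> weyl n \<and> dot n w (\<lambda>_. 0) = (\<lambda>i. of_int (lam i))", OF this]
  show ?thesis by (auto simp: u_elt_def)
qed
end

theorem theorem4p11:
  fixes n :: nat and \<tau> :: params and f :: cpoly and lam :: "nat \<Rightarrow> int"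
  assumes "n \<ge> 2"
    and "\<And>\<mu> \<nu>. \<mu> \<in> lattice n \<Longrightarrow> \<nu> \<in> lattice n \<Longrightarrow> \<mu> \<noteq> \<nu> \<Longrightarrow> gamma n \<tau> \<mu> \<noteq> gamma n \<tau> \<nu>"
    and "f \<in> polys n"
    and "lam \<in> lattice n"
  shows "poly_Y n \<tau> f (wilson_poly n \<tau> lam) =
    C (eval_at (gamma n \<tau> lam) f) * wilson_poly n \<tau> lam"
proof -
  interpret wilson n \<tau> by unfold_locales (rule assms(1))
  have "reduced_expr n (u_elt n lam) \<in> words n"
    by (intro reduced_expr u_elt_weyl assms)
  from joint_eigen_word[OF this] have "joint_eigen (gamma n \<tau> lam) (wilson_poly n \<tau> lam)"
    by (simp add: gamma_def dot_def wilson_poly_def S_elt_def)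
  then show ?thesis by (rule joint_eigen_poly_Y) (rule assms(3))
qed

end
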